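(* Let $\mathbb{S}\in\{\mathbb{J},\mathbb{L}\}$ and $A\in\mathbb{S}$. Let $\lambda\in\mathbb{C}$ and $x\in\mathbb{C}^n\setminus\{0\}$, and put $r:=\lambda x-Ax$. Suppose that $x$ and $r$ satisfy the following condition. Bilinear form: if ($M^T=M$ and $\mathbb{S}=\mathbb{L}$) or ($M^T=-M$ and $\mathbb{S}=\mathbb{J}$), then $x^TMr=0$; if ($M^T=M$ and $\mathbb{S}=\mathbb{J}$) or ($M^T=-M$ and $\mathbb{S}=\mathbb{L}$), there is no condition. Sesquilinear form: if ($M^H=M$ and $\mathbb{S}=\mathbb{J}$) or ($M^H=-M$ and $\mathbb{S}=\mathbb{L}$), then $x^HMr\in\mathbb{R}$; if ($M^H=M$ and $\mathbb{S}=\mathbb{L}$) or ($M^H=-M$ and $\mathbb{S}=\mathbb{J}$), then $x^HMr\in i\mathbb{R}$. Then $$\eta^{\mathbb{S}}_2(A,x,\lambda)=\|r\|_2/\|x\|_2\quad\text{and}\quad \eta^{\mathbb{S}}_F(A,x,\lambda)=\sqrt{2\|r\|_2^2-|\langle r,x\rangle_M|^2}.$$ Define $E$ by $$E:=\begin{cases}(x^Tr)M^{-1}\overline{x}x^H+M^{-1}\overline{x}r^T(I-xx^H)+M^{-1}(I-\overline{x}x^T)rx^H, & \text{if } MA\in\mathsf{sym},\\ M^{-1}(I-\overline{x}x^T)rx^H-M^{-1}\overline{x}r^T(I-xx^H), & \text{if } MA\in\mathsf{skew\mbox{-}sym},\\ (x^Hr)M^{-1}xx^H+M^{-1}xr^H(I-xx^H)+M^{-1}(I-xx^H)rx^H,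 & \text{if } MA\in\mathsf{Herm}.\end{cases}$$ Then $E\in\mathbb{S}$ is a unique matrix such that $(A+E)x=\lambda x$ and $\|E\|_F=\eta^{\mathbb{S}}_F(A,x,\lambda)$. Further, when $\|r\|_2\neq|x^Hr|$, define $$\Delta A:=\begin{cases}E-\dfrac{\overline{x^Tr}\,M^{-1}(I-xx^H)^Trr^T(I-xx^H)}{\|r\|_2^2-|x^Hr|^2}, & \text{if } MA\in\mathsf{sym},\\ E, & \text{if } MA\in\mathsf{skew\mbox{-}sym},\\ E-\dfrac{\overline{x^Hr}\,M^{-1}(I-xx^H)rr^H(I-xx^H)}{\|r\|_2^2-|x^Hr|^2}, & \text{if } MA\in\mathsf{Herm},\end{cases}$$ and otherwise set $\Delta A:=E$. Then $\Delta A\in\mathbb{S}$, $(A+\Delta A)x=\lambda x$ and $\|\Delta A\|_2=\eta^{\mathbb{S}}_2(A,x,\lambda)$.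
   Context: Here $\mathbb{K}=\mathbb{C}$. Let $M\in\mathbb{C}^{n\times n}$ be unitary. The scalar product on $\mathbb{C}^n$ is $\langle u,v\rangle_M=v^TMu$ (bilinear form; then $M^T=\pm M$) or $\langle u,v\rangle_M=v^HMu$ (sesquilinear form; then $M^H=\pm M$), where $T$ denotes transpose, $H$ conjugate transpose and a bar complex conjugation. The adjoint is $A^\star=M^{-1}A^TM$ (bilinear) or $A^\star=M^{-1}A^HM$ (sesquilinear). $\mathbb{L}=\{A\in\mathbb{C}^{n\times n}:A^\star=-A\}$ and $\mathbb{J}=\{A\in\mathbb{C}^{n\times n}:A^\star=A\}$ are the associated Lie and Jordan algebras. The sets $\mathsf{sym}$, $\mathsf{skew\mbox{-}sym}$ and $\mathsf{Herm}$ consist of the $n\times n$ matrices $B$ with $B^T=B$, $B^T=-B$ and $B^H=B$, respectively. The structured backward error of $(\lambda,x)$ as an approximate eigenpair of $A$ is $\eta^{\mathbb{S}}(A,x,\lambda):=\inf\{\|E-A\|:E\in\mathbb{S},\ Ex=\lambda x\}$, denoted $\eta^{\mathbb{S}}_2$ for the spectral norm $\|\cdot\|_2$ and $\eta^{\mathbb{S}}_F$ for the Frobenius norm $\|\cdot\|_F$.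
   Formalization: The formulas for η_F, E, ΔA are evaluated at x/‖x‖, r/‖x‖ (they fail for non-unit x); r becomes Mr in E and ΔA; |x^H r| becomes |⟨r,x⟩_M| in guard and denominators; the cases MA∈sym, skew-sym, Herm are read as cases on the set M𝕊, with no E, ΔA claim if M𝕊 is skew-Hermitian. *)

theory Defs
  imports "HOL-Analysis.Analysis"
begin

text \<open>
  Below, \<open>scalar_product u v\<close> is the library's \<open>u\<^sup>T v\<close> (no conjugation), and \<open>mat c ** B\<close> is the
  scalar multiple \<open>c B\<close>. The library norm on \<open>complex^'n\<close> is the Euclidean norm, and the one on
  \<open>complex^'n^'n\<close> is the Frobenius norm.
\<close>

definition vec_cnj :: "complex^'n \<Rightarrow> complex^'n" where
  "vec_cnj x = (\<chi> i. cnj (x $ i))"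

definition ctranspose :: "complex^'n^'n \<Rightarrow> complex^'n^'n" where
  "ctranspose A = map_matrix cnj (transpose A)"

definition outer_prod :: "complex^'n \<Rightarrow> complex^'n \<Rightarrow> complex^'n^'n" where
  "outer_prod u v = (\<chi> i j. u $ i * v $ j)"  \<comment> \<open>\<open>u v\<^sup>T\<close>; hence \<open>u v\<^sup>H\<close> is \<open>outer_prod u (vec_cnj v)\<close>\<close>

definition unitary :: "complex^'n^'n \<Rightarrow> bool" where
  "unitary M \<longleftrightarrow> ctranspose M ** M = mat 1 \<and> M ** ctranspose M = mat 1"

definition spectral_norm :: "complex^'n^'n \<Rightarrow> real" where
  "spectral_norm A = onorm (\<lambda>v. A *v v)"


datatype form = Bilinear | Sesquilinear

fun form_transpose :: "form \<Rightarrow> complex^'n^'n \<Rightarrow> complex^'n^'n" where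
  "form_transpose Bilinear A = transpose A"
| "form_transpose Sesquilinear A = ctranspose A"

fun form_prod :: "form \<Rightarrow> complex^'n^'n \<Rightarrow> complex^'n \<Rightarrow> complex^'n \<Rightarrow> complex" where
  "form_prod Bilinear M u v = scalar_product v (M *v u)"
| "form_prod Sesquilinear M u v = scalar_product (vec_cnj v) (M *v u)"

definition form_adjoint :: "form \<Rightarrow> complex^'n^'n \<Rightarrow> complex^'n^'n \<Rightarrow> complex^'n^'n" where
  "form_adjoint \<phi> M A = matrix_inv M ** form_transpose \<phi> A ** M"

definition lie_algebra :: "form \<Rightarrow> complex^'n^'n \<Rightarrow> (complex^'n^'n) set" where
  "lie_algebra \<phi> M = {A. form_adjoint \<phi> M A = - A}"

definition jordan_algebra :: "form \<Rightarrow> complex^'n^'n \<Rightarrow> (complex^'n^'n) set" where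
  "jordan_algebra \<phi> M = {A. form_adjoint \<phi> M A = A}"

definition sym_matrices :: "(complex^'n^'n) set" where
  "sym_matrices = {B. transpose B = B}"

definition skew_sym_matrices :: "(complex^'n^'n) set" where
  "skew_sym_matrices = {B. transpose B = - B}"

definition Herm_matrices :: "(complex^'n^'n) set" where
  "Herm_matrices = {B. ctranspose B = B}"


text \<open>
  The structured backward error, for an arbitrary matrix norm \<open>N\<close>. The infimum is the real one, so
  it is meaningful only if some \<open>E \<in> S\<close> satisfies \<open>E x = \<mu> x\<close>.
\<close>

definition backward_error ::
  "(complex^'n^'n \<Rightarrow> real) \<Rightarrow> (complex^'n^'n) set \<Rightarrow> complex^'n^'n \<Rightarrow> complex^'n \<Rightarrow> complex \<Rightarrow> real"
where
  "backward_error N S A x \<mu> = Inf {N (E - A) | E. E \<in> S \<and> E *v x = \<mu> *s x}"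


text \<open>
  The perturbations \<open>E\<close> and \<open>\<Delta>A\<close>, for a \<^emph>\<open>unit\<close> vector \<open>x\<close> and its residual \<open>r = \<mu> x - A x\<close>.
  The distinction \<open>M A \<in> sym\<close>, \<open>M A \<in> skew-sym\<close>, \<open>M A \<in> Herm\<close> is one on the structure \<open>S\<close> and not on the
  individual matrix \<open>A\<close> (for \<open>A = 0\<close> all three would hold): which of the three classes is
  \<open>M S = {M B | B \<in> S}\<close>. In the remaining case, \<open>M S\<close> skew-Hermitian, the matrices are left unspecified.

  The product \<open>M E\<close> has to map \<open>x\<close> to \<open>b = M r\<close>, so the formulas are in terms of \<open>b\<close>. The quantities
  \<open>x\<^sup>T b\<close> (for \<open>sym\<close>) and \<open>x\<^sup>H b\<close> (for \<open>Herm\<close>) are both the scalar product of \<open>r\<close> and \<open>x\<close>.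
\<close>

definition pert_E ::
  "complex^'n^'n \<Rightarrow> (complex^'n^'n) set \<Rightarrow> complex^'n \<Rightarrow> complex^'n \<Rightarrow> complex^'n^'n"
where
  "pert_E M S x r =
    (let b = M *v r; xc = vec_cnj x; bc = vec_cnj b; Mi = matrix_inv M; MS = (\<lambda>B. M ** B) ` S in
     if MS = sym_matrices then
       mat (scalar_product x b) ** Mi ** outer_prod xc xc
       + Mi ** outer_prod xc b ** (mat 1 - outer_prod x xc)
       + Mi ** (mat 1 - outer_prod xc x) ** outer_prod b xc
     else if MS = skew_sym_matrices then
       Mi ** (mat 1 - outer_prod xc x) ** outer_prod b xc
       - Mi ** outer_prod xc b ** (mat 1 - outer_prod x xc)
     else if MS = Herm_matrices then
       mat (scalar_product xc b) ** Mi ** outer_prod x xc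
       + Mi ** outer_prod x bc ** (mat 1 - outer_prod x xc)
       + Mi ** (mat 1 - outer_prod x xc) ** outer_prod b xc
     else undefined)"

definition pert_Delta ::
  "form \<Rightarrow> complex^'n^'n \<Rightarrow> (complex^'n^'n) set \<Rightarrow> complex^'n \<Rightarrow> complex^'n \<Rightarrow> complex^'n^'n"
where
  "pert_Delta \<phi> M S x r =
    (let b = M *v r; xc = vec_cnj x; bc = vec_cnj b; Mi = matrix_inv M; MS = (\<lambda>B. M ** B) ` S;
         d = (norm r)\<^sup>2 - (cmod (form_prod \<phi> M r x))\<^sup>2 in
     if norm r = cmod (form_prod \<phi> M r x) then pert_E M S x r
     else if MS = sym_matrices then
       pert_E M S x r
       - mat (cnj (scalar_product x b) / of_real d)
         ** Mi ** transpose (mat 1 - outer_prod x xc) ** outer_prod b b ** (mat 1 - outer_prod x xc)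
     else if MS = skew_sym_matrices then
       pert_E M S x r
     else if MS = Herm_matrices then
       pert_E M S x r
       - mat (cnj (scalar_product xc b) / of_real d)
         ** Mi ** (mat 1 - outer_prod x xc) ** outer_prod b bc ** (mat 1 - outer_prod x xc)
     else undefined)"

end

theory Submission
  imports Defs
begin

text \<open>
  Multiplication by the unitary \<open>M\<close> preserves both norms and maps \<open>S\<close> onto the matrices \<open>B\<close> whose
  transpose (or conjugate transpose) is \<open>\<epsilon> B\<close> for a sign \<open>\<epsilon> = \<plusminus>1\<close>, so the problem is to find such a \<open>B\<close>
  of minimal norm with \<open>B u = b\<close>, where \<open>u\<close> is a unit vector and \<open>b = M s\<close>. Put \<open>w = cnj u\<close> (bilinear)
  or \<open>w = u\<close> (sesquilinear), \<open>\<alpha> = w\<^sup>H b\<close> and \<open>c = b - \<alpha> w\<close>. In unitary bases starting with \<open>u\<close> and \<open>w\<close>,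
  \<open>B\<close> is a \<open>2 \<times> 2\<close> block matrix whose first column \<open>(\<alpha>, c)\<close> and first row are prescribed. The
  Frobenius norm is minimal exactly when the last block vanishes; this solution is orthogonal to the
  difference of any two solutions. The spectral norm is at least \<open>\<parallel>b\<parallel>\<close>, and the bound is attained by
  taking as last block the rank one matrix that makes \<open>B\<close> a multiple of an isometry on the plane
  spanned by \<open>u\<close> and the direction dual to \<open>c\<close>, and zero on its orthogonal complement.
\<close>

section \<open>Vectors, rank-one matrices and their norms\<close>

abbreviation dot_prod :: "complex^'n \<Rightarrow> complex^'n \<Rightarrow> complex" (infixl "\<odot>" 70) where
  "u \<odot> v \<equiv> scalar_product u v"

lemma vec_cnj_nth [simp]: "vec_cnj v $ i = cnj (v $ i)"
  by (simp add: vec_cnj_def)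

lemma vec_cnj_vec_cnj [simp]: "vec_cnj (vec_cnj v) = v"
  by (simp add: vec_eq_iff)

lemma norm_vec_cnj [simp]: "norm (vec_cnj v) = norm v"
  by (simp add: norm_vec_def)

lemma outer_prod_nth [simp]: "outer_prod u v $ i $ j = u $ i * v $ j"
  by (simp add: outer_prod_def)

lemma scalar_product_commute: "u \<odot> v = v \<odot> u"
  by (simp add: scalar_product_def mult.commute)

lemma scalar_product_algebra:
  "u \<odot> (v + w) = u \<odot> v + u \<odot> w" "(u + v) \<odot> w = u \<odot> w + v \<odot> w"
  "u \<odot> (v - w) = u \<odot> v - u \<odot> w" "(u - v) \<odot> w = u \<odot> w - v \<odot> w"
  "u \<odot> (k *s v) = k * (u \<odot> v)" "(k *s u) \<odot> v = k * (u \<odot> v)"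
  "u \<odot> (t *\<^sub>R v) = t * (u \<odot> v)" "(t *\<^sub>R u) \<odot> v = t * (u \<odot> v)"
  by (simp_all add: scalar_product_def algebra_simps sum.distrib sum_subtractf sum_distrib_left
      scaleR_conv_of_real[where 'a=complex])

lemma cnj_scalar_product: "cnj (u \<odot> v) = vec_cnj u \<odot> vec_cnj v"
  by (simp add: scalar_product_def)

lemma inner_eq_scalar_product: "u \<bullet> v = Re (u \<odot> vec_cnj v)"
  by (simp add: inner_vec_def scalar_product_def inner_complex_def)

lemma scalar_product_vec_cnj_self: "vec_cnj v \<odot> v = of_real ((norm v)\<^sup>2)"
proof -
  have "(norm v)\<^sup>2 = (\<Sum>i\<in>UNIV. (cmod (v $ i))\<^sup>2)"
    by (simp add: norm_vec_def L2_set_def sum_nonneg)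
  then show ?thesis
    by (simp add: scalar_product_def complex_norm_square mult.commute del: of_real_power)
qed

lemma cmod_scalar_product_le: "cmod (u \<odot> v) \<le> norm u * norm v"
proof -
  have "cmod (u \<odot> v) \<le> (\<Sum>i\<in>UNIV. \<bar>norm (u $ i)\<bar> * \<bar>norm (v $ i)\<bar>)"
    unfolding scalar_product_def by (rule order_trans[OF norm_sum]) (simp add: norm_mult)
  also have "\<dots> \<le> norm u * norm v"
    unfolding norm_vec_def by (rule L2_set_mult_ineq)
  finally show ?thesis .
qed

lemma norm_vector_scalar_mult: "norm (k *s v) = cmod k * norm (v :: complex^'n)"
  by (simp add: norm_vec_def norm_mult L2_set_right_distrib)

lemma norm_add_sq_hermitian_orthogonal:
  fixes v w :: "complex^'n"
  assumes "v \<odot> vec_cnj w = 0"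
  shows "(norm (v + w))\<^sup>2 = (norm v)\<^sup>2 + (norm w)\<^sup>2"
  using assms by (simp add: norm_add_Pythagorean orthogonal_def inner_eq_scalar_product)

text \<open>Against a rank-one matrix the Frobenius inner product sees only the value of
  \<open>W\<close> at one vector, so orthogonality becomes a statement about images.\<close>

lemma inner_outer_prod: "outer_prod u v \<bullet> W = Re (u \<odot> vec_cnj (W *v vec_cnj v))"
  by (simp add: inner_vec_def scalar_product_def inner_complex_def matrix_vector_mult_def
      sum_distrib_left sum_distrib_right algebra_simps)

lemma outer_prod_mult_vec: "outer_prod u v *v y = (v \<odot> y) *s u"
  by (simp add: vec_eq_iff matrix_vector_mult_def scalar_product_def sum_distrib_left
      sum_distrib_right algebra_simps)

lemma norm_outer_prod: "norm (outer_prod u v) = norm u * norm v"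
proof -
  have "vec_cnj ((v \<odot> vec_cnj v) *s u) = (vec_cnj v \<odot> v) *s vec_cnj u"
    by (simp add: vec_eq_iff cnj_scalar_product)
  then have "outer_prod u v \<bullet> outer_prod u v = Re ((vec_cnj v \<odot> v) * (vec_cnj u \<odot> u))"
    by (simp add: inner_outer_prod outer_prod_mult_vec scalar_product_algebra
        scalar_product_commute[of u])
  then have "(norm (outer_prod u v))\<^sup>2 = (norm u * norm v)\<^sup>2"
    unfolding scalar_product_vec_cnj_self power2_norm_eq_inner[of "outer_prod u v"]
    by (simp add: power_mult_distrib flip: of_real_mult of_real_power)
  then show ?thesis by simp
qed

lemma scalar_product_mult_vec: "(w \<odot> (A *v v)) = (transpose A *v w) \<odot> v"
  unfolding scalar_product_def matrix_vector_mult_def transpose_def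
  by (simp add: sum_distrib_left sum_distrib_right mult_ac, subst sum.swap, rule refl)

section \<open>Uniform treatment of the two kinds of form\<close>

fun form_cnj :: "form \<Rightarrow> complex \<Rightarrow> complex" where
  "form_cnj Bilinear z = z"
| "form_cnj Sesquilinear z = cnj z"

definition form_vec :: "form \<Rightarrow> complex^'n \<Rightarrow> complex^'n" where
  "form_vec \<phi> v = (\<chi> i. form_cnj \<phi> (v $ i))"

text \<open>In both cases this is an involutive field automorphism that fixes the reals and commutes
  with conjugation, so one argument can serve transposes and conjugate transposes alike.\<close>

lemma form_cnj_simps [simp]:
  "form_cnj \<phi> 0 = 0"
  "form_cnj \<phi> (z + z') = form_cnj \<phi> z + form_cnj \<phi> z'"
  "form_cnj \<phi> (z - z') = form_cnj \<phi> z - form_cnj \<phi> z'"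
  "form_cnj \<phi> (- z) = - form_cnj \<phi> z"
  "form_cnj \<phi> (z * z') = form_cnj \<phi> z * form_cnj \<phi> z'"
  "form_cnj \<phi> (z / z') = form_cnj \<phi> z / form_cnj \<phi> z'"
  "form_cnj \<phi> (of_real t) = of_real t"
  "form_cnj \<phi> (t *\<^sub>R z) = t *\<^sub>R form_cnj \<phi> z"
  "form_cnj \<phi> (form_cnj \<phi> z) = z"
  "form_cnj \<phi> (cnj z) = cnj (form_cnj \<phi> z)"
  "cmod (form_cnj \<phi> z) = cmod z"
  by (cases \<phi>; simp)+

lemma form_cnj_sum: "form_cnj \<phi> (\<Sum>i\<in>I. f i) = (\<Sum>i\<in>I. form_cnj \<phi> (f i))"
  by (cases \<phi>) auto

lemma form_vec_nth [simp]: "form_vec \<phi> v $ i = form_cnj \<phi> (v $ i)"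
  by (simp add: form_vec_def)

lemma form_vec_form_vec [simp]: "form_vec \<phi> (form_vec \<phi> v) = v"
  by (simp add: vec_eq_iff)

lemma norm_form_vec [simp]: "norm (form_vec \<phi> v) = norm v"
  by (simp add: norm_vec_def)

lemma form_vec_vec_cnj: "form_vec \<phi> (vec_cnj v) = vec_cnj (form_vec \<phi> v)"
  by (simp add: vec_eq_iff)

lemma form_cnj_scalar_product: "form_cnj \<phi> (u \<odot> v) = form_vec \<phi> u \<odot> form_vec \<phi> v"
  by (simp add: scalar_product_def form_cnj_sum)

lemma form_transpose_nth: "form_transpose \<phi> A $ i $ j = form_cnj \<phi> (A $ j $ i)"
  by (cases \<phi>) (simp_all add: transpose_def ctranspose_def map_matrix_def)

lemma form_prod_eq: "form_prod \<phi> M u v = form_vec \<phi> v \<odot> (M *v u)"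
  by (cases \<phi>) (simp_all add: form_vec_def vec_cnj_def)

section \<open>The interpolation problem \<open>B u = b\<close> with structured
  \<open>B\<close>\<close>

text \<open>
  The condition \<open>compat\<close> on \<open>\<alpha>\<close> is forced by any structured \<open>B\<close> with \<open>B u = b\<close>: it reads \<open>\<alpha> = \<alpha>\<close>
  (symmetric), \<open>\<alpha> = 0\<close> (skew-symmetric), \<open>\<alpha> \<in> \<real>\<close> (Hermitian) or \<open>\<alpha> \<in> \<i>\<real>\<close> (skew-Hermitian).
\<close>

locale structured_interpolation =
  fixes \<phi> :: form and \<epsilon> :: real and u b :: "complex^'n"
  assumes norm_u: "norm u = 1"
    and sign: "\<epsilon> = 1 \<or> \<epsilon> = -1"
    and compat: "form_cnj \<phi> (form_vec \<phi> u \<odot> b) = \<epsilon> * (form_vec \<phi> u \<odot> b)"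
begin

definition "\<alpha> = form_vec \<phi> u \<odot> b"
definition "w = form_vec \<phi> (vec_cnj u)"
definition "c = b - \<alpha> *s w"
text \<open>The first two terms prescribe the first column and the first row of the block matrix;
  each contains the corner entry \<open>\<alpha>\<close>, so the third removes one copy. The last
  block is zero.\<close>

definition "E = outer_prod b (vec_cnj u) + outer_prod (\<epsilon> *\<^sub>R w) (form_vec \<phi> b)
  - outer_prod (\<alpha> *s w) (vec_cnj u)"
definition "d = (norm b)\<^sup>2 - (cmod \<alpha>)\<^sup>2"
text \<open>If \<open>d = 0\<close> then \<open>c = 0\<close>, and the division by zero below is harmless.\<close>

definition "G = E - outer_prod ((\<epsilon> * (cnj \<alpha> / d)) *s c) (form_vec \<phi> c)"

lemma form_cnj_\<alpha>: "form_cnj \<phi> \<alpha> = \<epsilon> * \<alpha>"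
  using compat by (simp add: \<alpha>_def)

lemma sign_sq [simp]: "complex_of_real \<epsilon> * \<epsilon> = 1" "complex_of_real \<epsilon> * (\<epsilon> * z) = z"
  using sign by auto

lemma norm_w: "norm w = 1"
  by (simp add: w_def norm_u)

lemma vec_cnj_w: "vec_cnj w = form_vec \<phi> u"
  by (simp add: w_def form_vec_vec_cnj)

lemma u_u: "vec_cnj u \<odot> u = 1"
  by (simp add: scalar_product_vec_cnj_self norm_u)

lemma w_w: "vec_cnj w \<odot> w = 1"
  by (simp add: scalar_product_vec_cnj_self norm_w)

lemma w_c: "vec_cnj w \<odot> c = 0"
  by (simp add: c_def scalar_product_algebra w_w) (simp add: vec_cnj_w \<alpha>_def)

lemma norm_c_sq: "(norm c)\<^sup>2 = d"
proof -
  have "\<alpha> *s w \<odot> vec_cnj c = 0"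
    using arg_cong[OF w_c, of cnj] by (simp add: cnj_scalar_product scalar_product_algebra)
  then have "(norm (\<alpha> *s w + c))\<^sup>2 = (norm (\<alpha> *s w))\<^sup>2 + (norm c)\<^sup>2"
    by (rule norm_add_sq_hermitian_orthogonal)
  moreover have "\<alpha> *s w + c = b" by (simp add: c_def)
  ultimately show ?thesis by (simp add: norm_vector_scalar_mult norm_w d_def)
qed

text \<open>The compatibility condition seen from the row: row and column prescribe the same corner
  entry. Hence the last two terms of \<open>E\<close> cancel at \<open>u\<close>.\<close>

lemma form_vec_b_u: "form_vec \<phi> b \<odot> u = \<epsilon> * \<alpha>"
  using form_cnj_\<alpha> unfolding \<alpha>_def
  by (simp add: form_cnj_scalar_product scalar_product_commute)

lemma form_vec_c_u: "form_vec \<phi> c \<odot> u = 0"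
  using arg_cong[OF w_c, of "form_cnj \<phi>"]
  by (simp add: form_cnj_scalar_product vec_cnj_w scalar_product_commute)

lemma E_u: "E *v u = b"
  by (simp add: E_def matrix_vector_mult_add_rdistrib matrix_vector_mult_diff_rdistrib
      outer_prod_mult_vec u_u form_vec_b_u)
    (simp add: vec_eq_iff scaleR_conv_of_real[where 'a=complex] mult_ac)

lemma G_u: "G *v u = b"
  by (simp add: G_def matrix_vector_mult_diff_rdistrib E_u outer_prod_mult_vec form_vec_c_u)

text \<open>\<open>form_transpose\<close> interchanges the first two terms up to the sign
  \<open>\<epsilon>\<close>; the third reproduces itself up to that sign by
  \<open>form_cnj_\<alpha>\<close>.\<close>

lemma E_struct: "form_transpose \<phi> E = \<epsilon> *\<^sub>R E"
  by (simp add: vec_eq_iff form_transpose_nth E_def w_def form_cnj_\<alpha> scaleR_conv_of_real[where 'a=complex]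
      algebra_simps)

lemma G_struct: "form_transpose \<phi> G = \<epsilon> *\<^sub>R G"
proof -
  have "form_transpose \<phi> (outer_prod ((\<epsilon> * (cnj \<alpha> / d)) *s c) (form_vec \<phi> c))
      = \<epsilon> *\<^sub>R outer_prod ((\<epsilon> * (cnj \<alpha> / d)) *s c) (form_vec \<phi> c)"
    by (simp add: vec_eq_iff form_transpose_nth form_cnj_\<alpha> scaleR_conv_of_real[where 'a=complex])
  then show ?thesis
    using E_struct by (simp add: vec_eq_iff form_transpose_nth G_def scaleR_diff_right)
qed

text \<open>Absorbing the corner correction into the row turns \<open>b\<close> into
  \<open>c\<close>. As \<open>form_vec \<phi> c\<close> annihilates \<open>u\<close>, the two
  summands are Frobenius orthogonal and their squared norms add.\<close>

lemma E_split: "E = outer_prod b (vec_cnj u) + outer_prod w (\<epsilon> *\<^sub>R form_vec \<phi> c)"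
  by (simp add: vec_eq_iff E_def c_def w_def form_cnj_\<alpha> scaleR_conv_of_real[where 'a=complex] algebra_simps)

lemma norm_E_sq: "(norm E)\<^sup>2 = 2 * (norm b)\<^sup>2 - (cmod \<alpha>)\<^sup>2"
proof -
  have "outer_prod b (vec_cnj u) \<bullet> outer_prod w (\<epsilon> *\<^sub>R form_vec \<phi> c) = 0"
    by (simp add: inner_outer_prod outer_prod_mult_vec scalar_product_algebra form_vec_c_u)
      (simp add: scalar_product_def)
  then have "(norm E)\<^sup>2
      = (norm (outer_prod b (vec_cnj u)))\<^sup>2 + (norm (outer_prod w (\<epsilon> *\<^sub>R form_vec \<phi> c)))\<^sup>2"
    unfolding E_split by (simp add: norm_add_Pythagorean orthogonal_def)
  also have "\<dots> = (norm b)\<^sup>2 + d"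
    using sign by (auto simp: norm_outer_prod norm_u norm_w norm_c_sq)
  finally show ?thesis by (simp add: d_def)
qed

text \<open>The difference \<open>W\<close> of two solutions kills \<open>u\<close>, and by its
  structure it is also killed by \<open>w\<close> from the left. The summands of \<open>E\<close>
  are rank one with \<open>vec_cnj u\<close> on the right or \<open>w\<close> on the left, hence
  orthogonal to \<open>W\<close>. Minimality and uniqueness both follow from this identity.\<close>

lemma Pythagoras_E:
  assumes "form_transpose \<phi> B = \<epsilon> *\<^sub>R B" "B *v u = b"
  shows "(norm B)\<^sup>2 = (norm E)\<^sup>2 + (norm (B - E))\<^sup>2"
proof -
  define W where "W = B - E"
  have Wu: "W *v u = 0"
    by (simp add: W_def matrix_vector_mult_diff_rdistrib assms(2) E_u)
  have W: "form_transpose \<phi> W = \<epsilon> *\<^sub>R W"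
    using assms(1) E_struct by (simp add: W_def vec_eq_iff form_transpose_nth scaleR_diff_right)
  \<comment> \<open>The two transpositions leave \<open>form_cnj\<close> applied to the entries of
    \<open>W\<close>, so the structure of \<open>W\<close> turns \<open>W u = 0\<close> into a
    statement about its left kernel.\<close>
  have "transpose (form_transpose \<phi> W) *v form_vec \<phi> u = form_vec \<phi> (W *v u)"
    by (simp add: vec_eq_iff matrix_vector_mult_def form_transpose_nth form_cnj_sum transpose_def)
  then have "transpose (\<epsilon> *\<^sub>R W) *v vec_cnj w = 0"
    by (simp only: W Wu vec_cnj_w) (simp add: vec_eq_iff)
  moreover have "transpose (\<epsilon> *\<^sub>R W) *v y = \<epsilon> *\<^sub>R (transpose W *v y)" for y
    by (simp add: vec_eq_iff matrix_vector_mult_def transpose_def scaleR_sum_right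
        del: transpose_matrix_vector)
  ultimately have Ww: "transpose W *v vec_cnj w = 0"
    using sign by (auto simp del: transpose_matrix_vector)
  have "w \<odot> vec_cnj (W *v v) = 0" for v
    using arg_cong[OF scalar_product_mult_vec[of "vec_cnj w" W v], of cnj]
    by (simp add: cnj_scalar_product Ww scalar_product_def del: transpose_matrix_vector)
  then have "E \<bullet> W = 0"
    by (simp add: E_split inner_add_left inner_outer_prod Wu) (simp add: scalar_product_def)
  then have "(norm (E + W))\<^sup>2 = (norm E)\<^sup>2 + (norm W)\<^sup>2"
    by (simp add: norm_add_Pythagorean orthogonal_def)
  then show ?thesis by (simp add: W_def)
qed

text \<open>Let \<open>d\<close> be nonzero and \<open>n = norm c\<close>. In the orthonormal pairs
  given by \<open>u\<close> and the direction dual to \<open>c\<close>, and by \<open>w\<close> and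
  \<open>c / n\<close>, the matrix \<open>G\<close> has columns \<open>(\<alpha>, n)\<close> and
  \<open>\<epsilon> (n, - cnj \<alpha>)\<close>. The coefficient in \<open>G\<close> makes them
  orthogonal, both of length \<open>norm b\<close>.\<close>

lemma norm_G_mult_vec_le: "norm (G *v v) \<le> norm b * norm v"
proof -
  \<comment> \<open>\<open>a\<close> is the coordinate of \<open>v\<close> along \<open>u\<close>;
    for nonzero \<open>c\<close>, \<open>\<tau>\<close> is \<open>norm c\<close> times the
    coordinate along the direction dual to \<open>c\<close>.\<close>
  define a where "a = vec_cnj u \<odot> v"
  define \<tau> where "\<tau> = form_vec \<phi> c \<odot> v"
  have b: "form_vec \<phi> b \<odot> v = \<tau> + \<epsilon> * \<alpha> * a"
  proof -
    have "form_vec \<phi> b = form_vec \<phi> c + (\<epsilon> * \<alpha>) *s vec_cnj u"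
      by (simp add: vec_eq_iff c_def w_def form_cnj_\<alpha>)
    then show ?thesis by (simp add: scalar_product_algebra \<tau>_def a_def)
  qed
  have "G *v v = (a - \<epsilon> * (cnj \<alpha> / d) * \<tau>) *s c + (\<alpha> * a + \<epsilon> * \<tau>) *s w"
    unfolding G_def E_def matrix_vector_mult_add_rdistrib matrix_vector_mult_diff_rdistrib
      outer_prod_mult_vec b a_def[symmetric] \<tau>_def[symmetric]
    by (simp add: vec_eq_iff c_def scaleR_conv_of_real[where 'a=complex] algebra_simps)
  moreover have "((a - \<epsilon> * (cnj \<alpha> / d) * \<tau>) *s c) \<odot> vec_cnj ((\<alpha> * a + \<epsilon> * \<tau>) *s w) = 0"
  proof -
    have "vec_cnj ((\<alpha> * a + \<epsilon> * \<tau>) *s w) = cnj (\<alpha> * a + \<epsilon> * \<tau>) *s vec_cnj w"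
      by (simp add: vec_eq_iff)
    then show ?thesis by (simp only: scalar_product_algebra scalar_product_commute[of c] w_c) simp
  qed
  ultimately have "(norm (G *v v))\<^sup>2
      = (cmod (a - \<epsilon> * (cnj \<alpha> / d) * \<tau>))\<^sup>2 * d + (cmod (\<alpha> * a + \<epsilon> * \<tau>))\<^sup>2"
    by (simp only: norm_add_sq_hermitian_orthogonal norm_vector_scalar_mult norm_w
        power_mult_distrib norm_c_sq) simp
  also have "\<dots> \<le> (norm b)\<^sup>2 * (norm v)\<^sup>2"
  proof -
    have v: "v = a *s u + (v - a *s u)" by simp
    have "vec_cnj u \<odot> (v - a *s u) = 0"
      by (simp add: scalar_product_algebra u_u a_def)
    then have "u \<odot> vec_cnj (v - a *s u) = 0"
      using cnj_scalar_product[of "vec_cnj u" "v - a *s u"] by simp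
    then have "(a *s u) \<odot> vec_cnj (v - a *s u) = 0"
      by (simp add: scalar_product_algebra(6))
    then have nv: "(norm v)\<^sup>2 = (cmod a)\<^sup>2 + (norm (v - a *s u))\<^sup>2"
      by (subst v, subst norm_add_sq_hermitian_orthogonal)
        (simp_all add: norm_vector_scalar_mult norm_u)
    \<comment> \<open>\<open>\<tau>\<close> sees only the part of \<open>v\<close> orthogonal to
      \<open>u\<close>. Cauchy-Schwarz is applied to that part, since the whole of \<open>v\<close>
      would count \<open>a\<close> twice.\<close>
    have "\<tau> = form_vec \<phi> c \<odot> (v - a *s u)"
      by (simp add: scalar_product_algebra \<tau>_def form_vec_c_u)
    then have "cmod \<tau> \<le> norm c * norm (v - a *s u)"
      using cmod_scalar_product_le[of "form_vec \<phi> c"] by simp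
    then have t: "(cmod \<tau>)\<^sup>2 \<le> d * (norm (v - a *s u))\<^sup>2"
      using power_mono[of _ _ 2] by (fastforce simp: power_mult_distrib norm_c_sq)
    have nb: "(norm b)\<^sup>2 = d + (cmod \<alpha>)\<^sup>2" by (simp add: d_def)
    have d0: "d \<ge> 0" by (simp flip: norm_c_sq)
    show ?thesis
    proof (cases "d = 0")
      case True
      \<comment> \<open>Here \<open>t\<close> forces \<open>\<tau> = 0\<close>, and only the term
        \<open>\<alpha> * a\<close> is left.\<close>
      then show ?thesis using t
        by (simp add: nb nv norm_mult power_mult_distrib mult_left_mono)
    next
      case False
      \<comment> \<open>Writing each squared modulus as \<open>z * cnj z\<close> makes the identity
        algebraic; the cross terms cancel because the two columns are orthogonal.\<close>
      have "complex_of_real ((cmod (a - \<epsilon> * (cnj \<alpha> / d) * \<tau>))\<^sup>2 * d + (cmod (\<alpha> * a + \<epsilon> * \<tau>))\<^sup>2)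
        = of_real ((d + (cmod \<alpha>)\<^sup>2) * ((cmod a)\<^sup>2 + (cmod \<tau>)\<^sup>2 / d))"
        using False sign unfolding of_real_add of_real_mult of_real_divide complex_norm_square
        by (auto simp: field_simps)
      then have "(cmod (a - \<epsilon> * (cnj \<alpha> / d) * \<tau>))\<^sup>2 * d + (cmod (\<alpha> * a + \<epsilon> * \<tau>))\<^sup>2
        = (d + (cmod \<alpha>)\<^sup>2) * ((cmod a)\<^sup>2 + (cmod \<tau>)\<^sup>2 / d)"
        using of_real_eq_iff by blast
      moreover have "(cmod \<tau>)\<^sup>2 / d \<le> (norm (v - a *s u))\<^sup>2"
        using t False d0 by (simp add: divide_le_eq mult.commute)
      ultimately show ?thesis
        using d0 by (simp add: nb nv mult_left_mono)
    qed
  qed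
  finally have "(norm (G *v v))\<^sup>2 \<le> (norm b * norm v)\<^sup>2"
    by (simp only: power_mult_distrib)
  then show ?thesis
    by (rule power2_le_imp_le) simp
qed

end

section \<open>Matrix algebra and unitary matrices\<close>

lemma matrix_diff_ldistrib: "A ** (B - C) = A ** B - A ** (C :: complex^'n^'n)"
  by (simp add: vec_eq_iff matrix_matrix_mult_def sum_subtractf right_diff_distrib)

lemma matrix_diff_rdistrib: "(B - C) ** A = B ** A - C ** (A :: complex^'n^'n)"
  by (simp add: vec_eq_iff matrix_matrix_mult_def sum_subtractf left_diff_distrib)

lemma mat_matrix_mult_commute: "mat a ** B = B ** mat (a :: complex)"
proof -
  have "(mat a ** B) $ i $ j = a * B $ i $ j" for i j
    by (simp add: matrix_matrix_mult_def mat_def mult_delta_left)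
  moreover have "(B ** mat a) $ i $ j = B $ i $ j * a" for i j
    by (simp add: matrix_matrix_mult_def mat_def mult_delta_right)
  ultimately show ?thesis by (simp add: vec_eq_iff)
qed

lemma mat_mult_outer_prod: "mat a ** outer_prod u v = outer_prod (a *s u) v"
  by (simp add: vec_eq_iff matrix_matrix_mult_def mat_def mult_delta_left mult.assoc)

lemma outer_prod_mult: "outer_prod p q ** outer_prod u v = outer_prod ((q \<odot> u) *s p) v"
  by (simp add: vec_eq_iff matrix_matrix_mult_def scalar_product_def sum_distrib_left
      sum_distrib_right mult_ac)

lemma transpose_outer_prod: "transpose (outer_prod u v) = outer_prod v u"
  by (simp add: vec_eq_iff transpose_def mult.commute)

lemma transpose_diff: "transpose (A - B) = transpose A - transpose B"
  by (simp add: vec_eq_iff transpose_def)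

lemma form_transpose_add: "form_transpose \<phi> (A + B) = form_transpose \<phi> A + form_transpose \<phi> B"
  by (simp add: vec_eq_iff form_transpose_nth)

lemma form_transpose_mult:
  "form_transpose \<phi> (A ** B) = form_transpose \<phi> B ** form_transpose \<phi> A"
  by (simp add: vec_eq_iff matrix_matrix_mult_def form_transpose_nth form_cnj_sum mult.commute)

lemma unitary_matrix_inv: "unitary M \<Longrightarrow> matrix_inv M = ctranspose M"
proof -
  assume M: "unitary M"
  have "M ** matrix_inv M = mat 1 \<and> matrix_inv M ** M = mat 1"
    unfolding matrix_inv_def
    by (rule someI[of "\<lambda>X. M ** X = mat 1 \<and> X ** M = mat 1" "ctranspose M"])
      (use M in \<open>simp add: unitary_def\<close>)
  moreover have "ctranspose M ** M = mat 1"
    using M by (simp add: unitary_def)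
  ultimately show ?thesis
    using matrix_mul_assoc[of "ctranspose M" M "matrix_inv M"] by simp
qed

lemma unitary_inverse:
  assumes "unitary M"
  shows "matrix_inv M ** M = mat 1" "M ** matrix_inv M = mat 1" "unitary (matrix_inv M)"
proof -
  have "ctranspose (ctranspose M) = M"
    by (simp add: vec_eq_iff ctranspose_def transpose_def map_matrix_def)
  then show "matrix_inv M ** M = mat 1" "M ** matrix_inv M = mat 1" "unitary (matrix_inv M)"
    using assms by (simp_all add: unitary_matrix_inv unitary_def)
qed

lemma norm_unitary_mult_vec:
  assumes "unitary M"
  shows "norm (M *v v) = norm v"
proof -
  have "transpose M *v vec_cnj y = vec_cnj (ctranspose M *v y)" for y
    by (simp add: vec_eq_iff matrix_vector_mult_def transpose_def ctranspose_def map_matrix_def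
        del: transpose_matrix_vector)
  then have "vec_cnj (M *v v) \<odot> (M *v v) = vec_cnj (ctranspose M *v (M *v v)) \<odot> v"
    by (simp only: scalar_product_mult_vec)
  also have "\<dots> = vec_cnj v \<odot> v"
    using assms by (simp add: matrix_vector_mul_assoc unitary_def)
  finally have "(norm (M *v v))\<^sup>2 = (norm v)\<^sup>2"
    unfolding scalar_product_vec_cnj_self of_real_eq_iff .
  then show ?thesis by simp
qed

lemma norm_unitary_mult:
  fixes M B :: "complex^'n^'n"
  assumes "unitary M"
  shows "norm (M ** B) = norm B"
proof -
  \<comment> \<open>Left multiplication acts on columns, while the library norm sums over rows,
    hence the exchange of sums.\<close>
  have cols: "(norm C)\<^sup>2 = (\<Sum>j\<in>UNIV. (norm (column j C))\<^sup>2)" for C :: "complex^'n^'n"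
    by (simp add: norm_vec_def L2_set_def column_def sum_nonneg, rule sum.swap)
  have "column j (M ** B) = M *v column j B" for j
    by (simp add: vec_eq_iff column_def matrix_matrix_mult_def matrix_vector_mult_def)
  then have "(norm (M ** B))\<^sup>2 = (norm B)\<^sup>2"
    unfolding cols by (simp add: norm_unitary_mult_vec assms)
  then show ?thesis by simp
qed

section \<open>Spectral norm, adjoint and backward error\<close>

lemma norm_mult_vec_le_spectral_norm: "norm (A *v v) \<le> spectral_norm A * norm v"
  unfolding spectral_norm_def by (rule onorm) (rule matrix_vector_mul_bounded_linear)

text \<open>Multiplying by \<open>M\<close> and using its symmetry moves the adjoint condition onto
  \<open>M ** X\<close>, with sign \<open>t * \<delta>\<close>. The eight combinations of form,
  symmetry of \<open>M\<close> and algebra thus collapse to four structures.\<close>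

lemma form_adjoint_eq_iff:
  assumes "unitary M" "form_transpose \<phi> M = \<delta> *\<^sub>R M" "\<delta> = 1 \<or> \<delta> = -1"
  shows "form_adjoint \<phi> M X = t *\<^sub>R X \<longleftrightarrow> form_transpose \<phi> (M ** X) = (t * \<delta>) *\<^sub>R (M ** X)"
proof -
  have "form_adjoint \<phi> M X = t *\<^sub>R X \<longleftrightarrow> form_transpose \<phi> X ** M = M ** (t *\<^sub>R X)"
    unfolding form_adjoint_def
    by (metis matrix_mul_assoc matrix_mul_lid unitary_inverse(1,2)[OF assms(1)])
  also have "\<dots> \<longleftrightarrow> \<delta> *\<^sub>R (form_transpose \<phi> X ** M) = \<delta> *\<^sub>R (M ** (t *\<^sub>R X))"
    using assms(3) by auto
  also have "\<dots> \<longleftrightarrow> form_transpose \<phi> (M ** X) = (t * \<delta>) *\<^sub>R (M ** X)"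
    by (simp add: form_transpose_mult assms(2) matrix_scalar_ac scalar_matrix_assoc[symmetric]
        mult.commute)
  finally show ?thesis .
qed

text \<open>Subtracting \<open>A\<close> turns the infimum into one over the perturbations in
  \<open>S\<close> that send \<open>u\<close> to \<open>s\<close>. As \<open>X\<close> attains it,
  the real \<open>Inf\<close> is a genuine minimum.\<close>

lemma backward_error_eqI:
  assumes "\<And>E. E \<in> S \<longleftrightarrow> E - A \<in> S" and s: "s = \<mu> *s u - A *v u"
    and "X \<in> S" "X *v u = s" and "\<And>Y. Y \<in> S \<Longrightarrow> Y *v u = s \<Longrightarrow> N X \<le> N Y"
  shows "backward_error N S A u \<mu> = N X"
  unfolding backward_error_def
proof (rule cInf_eq_minimum)
  have "X + A \<in> S"
    using assms(1)[of "X + A"] assms(3) by simp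
  moreover have "(X + A) *v u = \<mu> *s u"
    using assms(4) by (simp add: matrix_vector_mult_add_rdistrib s)
  ultimately show "N X \<in> {N (E - A) |E. E \<in> S \<and> E *v u = \<mu> *s u}"
    by (intro CollectI exI[of _ "X + A"]) simp
next
  fix y
  assume "y \<in> {N (E - A) |E. E \<in> S \<and> E *v u = \<mu> *s u}"
  then obtain E where "y = N (E - A)" "E \<in> S" "E *v u = \<mu> *s u" by auto
  then show "N X \<le> y"
    using assms(1)[of E] assms(5)[of "E - A"] by (simp add: matrix_vector_mult_diff_rdistrib s)
qed

section \<open>Optimal perturbations for a unit vector\<close>

locale structured_eigenpair =
  fixes \<phi> :: form and \<epsilon> :: real and M A :: "complex^'n^'n" and S :: "(complex^'n^'n) set"
    and \<mu> :: complex and u s :: "complex^'n"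
  assumes unitary_M: "unitary M"
    and S_eq: "S = {X. form_transpose \<phi> (M ** X) = \<epsilon> *\<^sub>R (M ** X)}"
    and A_in_S: "A \<in> S"
    and s_eq: "s = \<mu> *s u - A *v u"
    and interp: "structured_interpolation \<phi> \<epsilon> u (M *v s)"
begin

sublocale structured_interpolation \<phi> \<epsilon> u "M *v s"
  by (fact interp)

lemma M_inv_cancel [simp]:
  "matrix_inv M ** (M ** X) = X" "M ** (matrix_inv M ** X) = X"
  "matrix_inv M *v (M *v v) = v"
  by (simp_all add: matrix_mul_assoc matrix_vector_mul_assoc unitary_inverse[OF unitary_M])

lemma S_add_iff: "X \<in> S \<Longrightarrow> X + Y \<in> S \<longleftrightarrow> Y \<in> S"
  by (simp add: S_eq matrix_add_ldistrib form_transpose_add scaleR_add_right)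

lemma S_diff_A: "X \<in> S \<longleftrightarrow> X - A \<in> S"
  using S_add_iff[OF A_in_S, of "X - A"] by simp

lemma M_inv_in_S: "form_transpose \<phi> B = \<epsilon> *\<^sub>R B \<Longrightarrow> matrix_inv M ** B \<in> S"
  by (simp add: S_eq)

lemma image_S: "(\<lambda>B. M ** B) ` S = {B. form_transpose \<phi> B = \<epsilon> *\<^sub>R B}"
proof (intro subset_antisym subsetI)
  fix B :: "complex^'n^'n"
  assume "B \<in> {B. form_transpose \<phi> B = \<epsilon> *\<^sub>R B}"
  then show "B \<in> (\<lambda>B. M ** B) ` S"
    by (intro image_eqI[of _ _ "matrix_inv M ** B"] M_inv_in_S) auto
qed (auto simp: S_eq)

lemma M_inv_mult_vec: "B *v u = M *v s \<Longrightarrow> (matrix_inv M ** B) *v u = s"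
  by (simp flip: matrix_vector_mul_assoc)

lemma norm_b: "norm (M *v s) = norm s"
  by (simp add: norm_unitary_mult_vec unitary_M)

lemma norm_M_mult: "norm (M ** X) = norm X" for X :: "complex^'n^'n"
  by (rule norm_unitary_mult[OF unitary_M])

lemma norm_M_inv_mult: "norm (matrix_inv M ** X) = norm X" for X :: "complex^'n^'n"
  by (rule norm_unitary_mult[OF unitary_inverse(3)[OF unitary_M]])

lemma norm_M_inv_mult_vec: "norm ((matrix_inv M ** X) *v v) = norm (X *v v)"
  using norm_unitary_mult_vec[OF unitary_inverse(3)[OF unitary_M], of "X *v v"]
  by (simp only: matrix_vector_mul_assoc)

lemma norm_E: "norm (matrix_inv M ** E) = sqrt (2 * (norm s)\<^sup>2 - (cmod (form_prod \<phi> M s u))\<^sup>2)"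
proof -
  have "form_prod \<phi> M s u = \<alpha>" by (simp add: form_prod_eq \<alpha>_def)
  then have "(norm (matrix_inv M ** E))\<^sup>2 = 2 * (norm s)\<^sup>2 - (cmod (form_prod \<phi> M s u))\<^sup>2"
    using norm_E_sq by (simp add: norm_M_inv_mult norm_b)
  then show ?thesis
    by (rule real_sqrt_unique[symmetric]) simp
qed

lemma norm_sq_Pythagoras:
  assumes "X \<in> S" "X *v u = s"
  shows "(norm X)\<^sup>2 = (norm (matrix_inv M ** E))\<^sup>2 + (norm (X - matrix_inv M ** E))\<^sup>2"
proof -
  have "form_transpose \<phi> (M ** X) = \<epsilon> *\<^sub>R (M ** X)"
    using assms(1) by (simp add: S_eq)
  moreover have "(M ** X) *v u = M *v s"
    by (simp only: matrix_vector_mul_assoc[symmetric] assms(2))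
  ultimately have "(norm (M ** X))\<^sup>2 = (norm E)\<^sup>2 + (norm (M ** X - E))\<^sup>2"
    by (rule Pythagoras_E)
  moreover have "M ** X - E = M ** (X - matrix_inv M ** E)"
    by (simp add: matrix_diff_ldistrib)
  ultimately show ?thesis
    by (simp only: norm_M_mult norm_M_inv_mult)
qed

lemma backward_error_Frobenius: "backward_error norm S A u \<mu> = norm (matrix_inv M ** E)"
proof (rule backward_error_eqI[OF S_diff_A s_eq M_inv_in_S[OF E_struct] M_inv_mult_vec[OF E_u]])
  fix Y
  assume "Y \<in> S" "Y *v u = s"
  then have "(norm (matrix_inv M ** E))\<^sup>2 \<le> (norm Y)\<^sup>2"
    using norm_sq_Pythagoras[of Y] by simp
  then show "norm (matrix_inv M ** E) \<le> norm Y"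
    by (rule power2_le_imp_le) simp
qed

text \<open>Equality of norms leaves nothing for the last square in
  \<open>norm_sq_Pythagoras\<close>.\<close>

lemma minimizer_unique:
  assumes "X \<in> S" "X *v u = s" "norm X = backward_error norm S A u \<mu>"
  shows "X = matrix_inv M ** E"
  using norm_sq_Pythagoras[OF assms(1,2)] assms(3) by (simp add: backward_error_Frobenius)

lemma norm_s_le_spectral_norm: "X *v u = s \<Longrightarrow> norm s \<le> spectral_norm X"
  using norm_mult_vec_le_spectral_norm[of X u] by (simp add: norm_u)

lemma spectral_norm_G: "spectral_norm (matrix_inv M ** G) = norm s"
proof (rule antisym)
  show "spectral_norm (matrix_inv M ** G) \<le> norm s"
    unfolding spectral_norm_def
    by (rule onorm_le) (simp only: norm_M_inv_mult_vec norm_G_mult_vec_le[unfolded norm_b])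
qed (simp add: norm_s_le_spectral_norm M_inv_mult_vec G_u)

lemma backward_error_spectral: "backward_error spectral_norm S A u \<mu> = norm s"
  using backward_error_eqI[OF S_diff_A s_eq M_inv_in_S[OF G_struct] M_inv_mult_vec[OF G_u],
      of spectral_norm] norm_s_le_spectral_norm
  by (simp add: spectral_norm_G)

section \<open>The explicit formulas for the perturbations\<close>

lemma image_S_cases:
  assumes "(\<lambda>B. M ** B) ` S \<in> {sym_matrices, skew_sym_matrices, Herm_matrices}"
  obtains (sym) "\<phi> = Bilinear" "\<epsilon> = 1" "(\<lambda>B. M ** B) ` S = sym_matrices"
  | (skew) "\<phi> = Bilinear" "\<epsilon> = -1" "(\<lambda>B. M ** B) ` S = skew_sym_matrices"
      "(\<lambda>B. M ** B) ` S \<noteq> sym_matrices"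
  | (Herm) "\<phi> = Sesquilinear" "\<epsilon> = 1" "(\<lambda>B. M ** B) ` S = Herm_matrices"
      "(\<lambda>B. M ** B) ` S \<noteq> sym_matrices" "(\<lambda>B. M ** B) ` S \<noteq> skew_sym_matrices"
proof -
  \<comment> \<open>The formulas are selected by comparing whole classes, so the classes must be
    told apart. Scalar matrices do this in every dimension, with \<open>k = 1\<close> and
    \<open>k = \<i>\<close>.\<close>
  have mem: "mat k \<in> (\<lambda>B. M ** B) ` S \<longleftrightarrow> form_cnj \<phi> k = \<epsilon> * k" for k :: complex
    by (auto simp: image_S vec_eq_iff form_transpose_nth mat_def scaleR_conv_of_real[where 'a=complex])
  have [simp]: "mat k \<in> sym_matrices"
    "mat k \<in> skew_sym_matrices \<longleftrightarrow> k = 0" "mat k \<in> Herm_matrices \<longleftrightarrow> k \<in> \<real>" for k :: complex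
    by (auto simp: sym_matrices_def skew_sym_matrices_def Herm_matrices_def ctranspose_def
        map_matrix_def transpose_def vec_eq_iff mat_def Reals_cnj_iff)
  have ne: "(\<lambda>B. M ** B) ` S \<noteq> T" if "mat k \<in> T \<longleftrightarrow> form_cnj \<phi> k \<noteq> \<epsilon> * k" for T and k :: complex
    using that mem by blast
  consider "\<phi> = Bilinear" "\<epsilon> = 1" | "\<phi> = Bilinear" "\<epsilon> = -1"
    | "\<phi> = Sesquilinear" "\<epsilon> = 1" | "\<phi> = Sesquilinear" "\<epsilon> = -1"
    using sign by (cases \<phi>) auto
  then show thesis
  proof cases
    case 1
    then show thesis by (intro sym) (auto simp: image_S sym_matrices_def)
  next
    case 2
    then show thesis
      by (intro skew ne[of 1]) (auto simp: image_S skew_sym_matrices_def)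
  next
    case 3
    then show thesis
      by (intro Herm ne[of \<i>] ne[of 1]) (auto simp: image_S Herm_matrices_def)
  next
    case 4
    then have False
      using assms ne[of 1 sym_matrices] ne[of \<i> skew_sym_matrices] ne[of \<i> Herm_matrices]
      by (auto simp: complex_is_Real_iff)
    then show thesis ..
  qed
qed

text \<open>For \<open>sym\<close> and \<open>Herm\<close> each of the two projections removes the
  corner term once and the explicit scalar term restores one copy, leaving the single correction in
  \<open>E\<close>. In the skew-symmetric case \<open>\<alpha> = 0\<close>, and the projections
  change nothing.\<close>

lemma pert_E_eq:
  assumes "(\<lambda>B. M ** B) ` S \<in> {sym_matrices, skew_sym_matrices, Herm_matrices}"
  shows "pert_E M S u s = matrix_inv M ** E"
proof -
  have fv: "form_vec Bilinear v = v" "form_vec Sesquilinear v = vec_cnj v" for v :: "complex^'n"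
    by (simp_all add: vec_eq_iff)
  have zero: "0 *s v = 0" "outer_prod 0 v = 0" for v :: "complex^'n"
    by (simp_all add: vec_eq_iff)
  have outer_minus: "outer_prod (- v) v' = - outer_prod v v'" for v v' :: "complex^'n"
    by (simp add: vec_eq_iff)
  have mult_minus: "X ** (- Y) = - (X ** Y)" "X ** 0 = 0" for X Y :: "complex^'n^'n"
    by (simp_all add: vec_eq_iff matrix_matrix_mult_def sum_negf)
  note simps = matrix_mul_assoc[symmetric] matrix_add_ldistrib matrix_diff_ldistrib
    matrix_diff_rdistrib outer_prod_mult mat_mult_outer_prod outer_minus mult_minus zero
  show ?thesis
    using assms
  proof (cases rule: image_S_cases)
    case sym
    have "u \<odot> (M *v s) = \<alpha>" "(M *v s) \<odot> u = \<alpha>"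
      unfolding \<alpha>_def unfolding sym(1) fv by (simp_all add: scalar_product_commute)
    moreover have "E = outer_prod (M *v s) (vec_cnj u) + outer_prod (vec_cnj u) (M *v s)
        - outer_prod (\<alpha> *s vec_cnj u) (vec_cnj u)"
      unfolding E_def w_def unfolding sym(1,2) fv by simp
    ultimately show ?thesis
      using sym(3) unfolding pert_E_def Let_def mat_matrix_mult_commute[of _ "matrix_inv M"]
      by (simp add: simps)
  next
    case skew
    have \<alpha>: "\<alpha> = 0" using skew(1,2) form_cnj_\<alpha> by simp
    then have "u \<odot> (M *v s) = 0" "(M *v s) \<odot> u = 0"
      using form_vec_b_u unfolding \<alpha>_def unfolding skew(1) fv by (simp_all add: scalar_product_commute)
    moreover have "E = outer_prod (M *v s) (vec_cnj u) - outer_prod (vec_cnj u) (M *v s)"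
      unfolding E_def w_def \<alpha> unfolding skew(1,2) fv by (simp add: zero outer_minus)
    ultimately show ?thesis
      using skew(3,4) unfolding pert_E_def Let_def mat_matrix_mult_commute[of _ "matrix_inv M"]
      by (simp add: simps)
  next
    case Herm
    have "vec_cnj u \<odot> (M *v s) = \<alpha>" "vec_cnj (M *v s) \<odot> u = \<alpha>"
      using form_vec_b_u unfolding \<alpha>_def unfolding Herm(1,2) fv by simp_all
    moreover have "E = outer_prod (M *v s) (vec_cnj u) + outer_prod u (vec_cnj (M *v s))
        - outer_prod (\<alpha> *s u) (vec_cnj u)"
      unfolding E_def w_def unfolding Herm(1,2) fv by simp
    ultimately show ?thesis
      using Herm(3-5) unfolding pert_E_def Let_def mat_matrix_mult_commute[of _ "matrix_inv M"]
      by (simp add: simps)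
  qed
qed

text \<open>The left factor is the projection orthogonal to \<open>w\<close>, which sends
  \<open>M *v s\<close> to \<open>c\<close>; the right factor does the same to the row.\<close>

lemma project_outer_prod:
  "(mat 1 - outer_prod w (form_vec \<phi> u)) ** outer_prod (M *v s) (form_vec \<phi> (M *v s))
    ** (mat 1 - outer_prod u (vec_cnj u)) = outer_prod c (form_vec \<phi> c)"
proof -
  have "outer_prod p q - outer_prod p (k *s q') = outer_prod p (q - k *s q')"
    and "outer_prod p q - outer_prod (k *s p') q = outer_prod (p - k *s p') q"
    and "outer_prod (k *s p) q = outer_prod p (k *s q)" for p p' q q' :: "complex^'n" and k
    by (simp_all add: vec_eq_iff algebra_simps)
  moreover have "form_vec \<phi> c = form_vec \<phi> (M *v s) - (\<epsilon> * \<alpha>) *s vec_cnj u"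
    by (simp add: vec_eq_iff c_def w_def form_cnj_\<alpha>)
  ultimately show ?thesis
    by (simp add: matrix_diff_ldistrib matrix_diff_rdistrib outer_prod_mult \<alpha>_def[symmetric]
        form_vec_b_u c_def[symmetric])
qed

lemma pert_Delta_eq:
  assumes "(\<lambda>B. M ** B) ` S \<in> {sym_matrices, skew_sym_matrices, Herm_matrices}"
  shows "pert_Delta \<phi> M S u s = matrix_inv M ** G"
proof -
  have fv: "form_vec Bilinear v = v" "form_vec Sesquilinear v = vec_cnj v" for v :: "complex^'n"
    by (simp_all add: vec_eq_iff)
  have zero: "outer_prod 0 v = 0" for v :: "complex^'n"
    by (simp add: vec_eq_iff)
  have \<alpha>: "form_prod \<phi> M s u = \<alpha>"
    by (simp add: form_prod_eq \<alpha>_def)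
  have d: "(norm s)\<^sup>2 - (cmod \<alpha>)\<^sup>2 = d"
    by (simp add: d_def norm_b)
  have E: "pert_E M S u s = matrix_inv M ** E"
    by (rule pert_E_eq[OF assms])
  have tr: "transpose (mat 1 - outer_prod u (vec_cnj u)) = mat 1 - outer_prod (vec_cnj u) u"
    by (simp add: transpose_diff transpose_outer_prod)
  \<comment> \<open>This serves the symmetric and the Hermitian case together; both have
    \<open>\<epsilon> = 1\<close>, so the coefficient is the one in the formulas.\<close>
  have G: "matrix_inv M ** E - mat k ** matrix_inv M ** (mat 1 - outer_prod w (form_vec \<phi> u))
      ** outer_prod (M *v s) (form_vec \<phi> (M *v s)) ** (mat 1 - outer_prod u (vec_cnj u))
      = matrix_inv M ** G" if "k = \<epsilon> * (cnj \<alpha> / d)" for k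
  proof -
    have "mat k ** matrix_inv M ** (mat 1 - outer_prod w (form_vec \<phi> u))
      ** outer_prod (M *v s) (form_vec \<phi> (M *v s)) ** (mat 1 - outer_prod u (vec_cnj u))
      = matrix_inv M ** (mat k ** outer_prod c (form_vec \<phi> c))"
      by (simp only: mat_matrix_mult_commute[of _ "matrix_inv M"] matrix_mul_assoc[symmetric]
          project_outer_prod[unfolded matrix_mul_assoc[symmetric]])
    then show ?thesis
      by (simp only: G_def matrix_diff_ldistrib mat_mult_outer_prod that)
  qed
  show ?thesis
  proof (cases "norm s = cmod \<alpha>")
    case True
    \<comment> \<open>Division by zero gives zero, so \<open>G\<close> reduces to \<open>E\<close>,
      the value that \<open>pert_Delta\<close> prescribes here.\<close>
    then have "d = 0" using d by simp
    then show ?thesis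
      unfolding pert_Delta_def Let_def \<alpha> E using True by (simp add: G_def zero)
  next
    case False
    show ?thesis
      using assms
    proof (cases rule: image_S_cases)
      case sym
      have fvu: "form_vec \<phi> v = v" for v :: "complex^'n" unfolding sym(1) fv ..
      have wu: "w = vec_cnj u" unfolding w_def fvu ..
      have \<alpha>': "u \<odot> (M *v s) = \<alpha>" unfolding \<alpha>_def fvu ..
      have "cnj \<alpha> / d = \<epsilon> * (cnj \<alpha> / d)" unfolding sym(2) by simp
      from G[OF this, unfolded wu fvu] show ?thesis
        unfolding pert_Delta_def Let_def \<alpha> d E tr \<alpha>' using False sym(3) by simp
    next
      case skew
      have "\<alpha> = 0" using skew form_cnj_\<alpha> by simp
      then have "E = G" by (simp add: G_def zero)
      then show ?thesis
        unfolding pert_Delta_def Let_def \<alpha> E using False skew(3,4) by simp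
    next
      case Herm
      have fvu: "form_vec \<phi> v = vec_cnj v" for v :: "complex^'n" unfolding Herm(1) fv ..
      have wu: "w = u" unfolding w_def fvu by simp
      have \<alpha>': "vec_cnj u \<odot> (M *v s) = \<alpha>" unfolding \<alpha>_def fvu ..
      have "cnj \<alpha> / d = \<epsilon> * (cnj \<alpha> / d)" unfolding Herm(2) by simp
      from G[OF this, unfolded wu fvu] show ?thesis
        unfolding pert_Delta_def Let_def \<alpha> d E \<alpha>' using False Herm(3-5) by simp
    qed
  qed
qed

end

section \<open>Normalization of the vector and the theorem\<close>

lemma complex_matrix_vector_mult_scaleR: "A *v (k *\<^sub>R x) = k *\<^sub>R (A *v (x :: complex^'n))"
  by (rule linear_scale[OF matrix_vector_mul_linear])

text \<open>The eigenvector equation is homogeneous in \<open>x\<close>, so \<open>x\<close> may be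
  replaced by a unit vector.\<close>

lemma backward_error_scaleR:
  assumes "k \<noteq> 0"
  shows "backward_error N S A (k *\<^sub>R x) \<mu> = backward_error N S A x \<mu>"
proof -
  have "E *v (k *\<^sub>R x) = \<mu> *s (k *\<^sub>R x) \<longleftrightarrow> E *v x = \<mu> *s x" for E
  proof -
    have "\<mu> *s (k *\<^sub>R x) = k *\<^sub>R (\<mu> *s x)"
      by (simp add: vec_eq_iff)
    then show ?thesis using assms by (simp add: complex_matrix_vector_mult_scaleR)
  qed
  then show ?thesis by (simp add: backward_error_def)
qed

theorem corollary4p1:
  fixes \<phi> :: form and M A :: "complex^'n^'n" and S :: "(complex^'n^'n) set"
    and \<mu> :: complex and x r :: "complex^'n"
  assumes "unitary M"
    and "form_transpose \<phi> M = M \<or> form_transpose \<phi> M = - M"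
    and "S = jordan_algebra \<phi> M \<or> S = lie_algebra \<phi> M"
    and "A \<in> S"
    and "x \<noteq> 0"
    and "r = \<mu> *s x - A *v x"
    and "\<phi> = Bilinear \<Longrightarrow>
           (transpose M = M \<and> S = lie_algebra \<phi> M) \<or> (transpose M = - M \<and> S = jordan_algebra \<phi> M) \<Longrightarrow>
           scalar_product x (M *v r) = 0"
    and "\<phi> = Sesquilinear \<Longrightarrow>
           (ctranspose M = M \<and> S = jordan_algebra \<phi> M) \<or> (ctranspose M = - M \<and> S = lie_algebra \<phi> M) \<Longrightarrow>
           scalar_product (vec_cnj x) (M *v r) \<in> \<real>"
    and "\<phi> = Sesquilinear \<Longrightarrow>
           (ctranspose M = M \<and> S = lie_algebra \<phi> M) \<or> (ctranspose M = - M \<and> S = jordan_algebra \<phi> M) \<Longrightarrow>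
           scalar_product (vec_cnj x) (M *v r) \<in> (\<lambda>t. \<i> * t) ` \<real>"
  shows "backward_error spectral_norm S A x \<mu> = norm r / norm x
    \<and> (let u = (1 / norm x) *\<^sub>R x;
           s = \<mu> *s u - A *v u;
           MS = (\<lambda>B. M ** B) ` S;
           E = pert_E M S u s;
           \<Delta>A = pert_Delta \<phi> M S u s
       in backward_error norm S A x \<mu> = sqrt (2 * (norm s)\<^sup>2 - (cmod (form_prod \<phi> M s u))\<^sup>2)
        \<and> (MS \<in> {sym_matrices, skew_sym_matrices, Herm_matrices} \<longrightarrow>
             E \<in> S \<and> (A + E) *v x = \<mu> *s x \<and> norm E = backward_error norm S A x \<mu>
             \<and> (\<forall>X. X \<in> S \<and> (A + X) *v x = \<mu> *s x \<and> norm X = backward_error norm S A x \<mu> \<longrightarrow> X = E)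
             \<and> \<Delta>A \<in> S \<and> (A + \<Delta>A) *v x = \<mu> *s x
             \<and> spectral_norm \<Delta>A = backward_error spectral_norm S A x \<mu>))"
proof -
  obtain \<delta> :: real where \<delta>: "form_transpose \<phi> M = \<delta> *\<^sub>R M" "\<delta> = 1 \<or> \<delta> = -1"
    using assms(2) by (metis scaleR_minus1_left scaleR_one)
  obtain t :: real where t: "S = {X. form_adjoint \<phi> M X = t *\<^sub>R X}" "t = 1 \<or> t = -1"
    and t1: "t = 1 \<longrightarrow> S = jordan_algebra \<phi> M" and t2: "t = -1 \<longrightarrow> S = lie_algebra \<phi> M"
  proof (cases "S = jordan_algebra \<phi> M")
    case True
    then show thesis by (intro that[of 1]) (auto simp: jordan_algebra_def)
  next
    case False
    then show thesis using assms(3) by (intro that[of "-1"]) (auto simp: lie_algebra_def)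
  qed
  define \<epsilon> where "\<epsilon> = t * \<delta>"
  define u where "u = (1 / norm x) *\<^sub>R x"
  define s where "s = \<mu> *s u - A *v u"
  have s: "s = (1 / norm x) *\<^sub>R r"
    unfolding s_def u_def assms(6)
    by (simp add: vec_eq_iff complex_matrix_vector_mult_scaleR scaleR_diff_right right_diff_distrib)
  \<comment> \<open>In each of the four structures the hypothesis on \<open>x\<close> and
    \<open>r\<close> yields the compatibility condition, which is trivial for
    \<open>Bilinear\<close> with \<open>\<epsilon> = 1\<close>.\<close>
  have "form_cnj \<phi> (form_vec \<phi> x \<odot> (M *v r)) = \<epsilon> * (form_vec \<phi> x \<odot> (M *v r))"
  proof (cases \<phi>)
    case Bilinear
    then have "form_vec \<phi> x = x" by (simp add: vec_eq_iff)
    then show ?thesis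
      using Bilinear \<delta> t(2) t1 t2 assms(7) by (auto simp: \<epsilon>_def)
  next
    case Sesquilinear
    then have "form_vec \<phi> x = vec_cnj x" by (simp add: vec_eq_iff)
    then show ?thesis
      using Sesquilinear \<delta> t(2) t1 t2 assms(8,9) by (auto simp: \<epsilon>_def Reals_cnj_iff)
  qed
  \<comment> \<open>Normalization multiplies this value by a positive real, which
    \<open>form_cnj\<close> fixes, so compatibility passes to \<open>u\<close> and
    \<open>s\<close>.\<close>
  moreover have "form_vec \<phi> u \<odot> (M *v s) = of_real ((1 / norm x)\<^sup>2) * (form_vec \<phi> x \<odot> (M *v r))"
  proof -
    have "form_vec \<phi> u = (1 / norm x) *\<^sub>R form_vec \<phi> x"
      by (simp add: vec_eq_iff u_def)
    then show ?thesis
      by (simp add: s complex_matrix_vector_mult_scaleR scalar_product_algebra power2_eq_square)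
  qed
  ultimately have "form_cnj \<phi> (form_vec \<phi> u \<odot> (M *v s)) = \<epsilon> * (form_vec \<phi> u \<odot> (M *v s))"
    by (simp del: of_real_power)
  then have "structured_interpolation \<phi> \<epsilon> u (M *v s)"
    using \<delta>(2) t(2) assms(5) by unfold_locales (auto simp: \<epsilon>_def u_def)
  moreover have "S = {X. form_transpose \<phi> (M ** X) = \<epsilon> *\<^sub>R (M ** X)}"
    using form_adjoint_eq_iff[OF assms(1) \<delta>] by (simp add: t(1) \<epsilon>_def)
  ultimately interpret structured_eigenpair \<phi> \<epsilon> M A S \<mu> u s
    using assms(1,4) s_def by (intro structured_eigenpair.intro)
  \<comment> \<open>The conclusion speaks of \<open>x\<close>, while the constructed matrices solve
    \<open>X u = s\<close>; scaling by \<open>1 / norm x\<close> links the two.\<close>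
  have solve_iff: "(A + X) *v x = \<mu> *s x \<longleftrightarrow> X *v u = s" for X
  proof -
    have "X *v u = s \<longleftrightarrow> (1 / norm x) *\<^sub>R (X *v x) = (1 / norm x) *\<^sub>R r"
      by (simp add: s u_def complex_matrix_vector_mult_scaleR)
    also have "\<dots> \<longleftrightarrow> X *v x = \<mu> *s x - A *v x"
      using assms(5,6) by simp
    finally show ?thesis
      by (auto simp: matrix_vector_mult_add_rdistrib algebra_simps)
  qed
  have be: "backward_error N S A x \<mu> = backward_error N S A u \<mu>" for N
    unfolding u_def using assms(5) by (simp add: backward_error_scaleR)
  show ?thesis
    unfolding Let_def u_def[symmetric] s_def[symmetric] be solve_iff
  proof (intro conjI impI allI; (elim conjE)?)
    show "backward_error spectral_norm S A u \<mu> = norm r / norm x"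
      by (simp add: backward_error_spectral s)
    show "backward_error norm S A u \<mu> = sqrt (2 * (norm s)\<^sup>2 - (cmod (form_prod \<phi> M s u))\<^sup>2)"
      by (simp add: backward_error_Frobenius norm_E)
  next
    assume MS: "(\<lambda>B. M ** B) ` S \<in> {sym_matrices, skew_sym_matrices, Herm_matrices}"
    note eqs = pert_E_eq[OF MS] pert_Delta_eq[OF MS]
    show "pert_E M S u s \<in> S" "pert_E M S u s *v u = s"
      "norm (pert_E M S u s) = backward_error norm S A u \<mu>"
      by (simp_all add: eqs M_inv_in_S E_struct M_inv_mult_vec E_u backward_error_Frobenius)
    show "X = pert_E M S u s"
      if "X \<in> S" "X *v u = s" "norm X = backward_error norm S A u \<mu>" for X
      using minimizer_unique[OF that] by (simp add: eqs)
    show "pert_Delta \<phi> M S u s \<in> S" "pert_Delta \<phi> M S u s *v u = s"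
      "spectral_norm (pert_Delta \<phi> M S u s) = backward_error spectral_norm S A u \<mu>"
      by (simp_all add: eqs M_inv_in_S G_struct M_inv_mult_vec G_u spectral_norm_G
          backward_error_spectral)
  qed
qed

end
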